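(* Let $P_0,P_1$ be distributions with $\Delta(\ell)<\infty$, let $\epsilon>0$, and let $n\ge 1$. Then the randomized algorithm $X\mapsto \mathrm{OfflinePCPD}(X,P_0,P_1,\epsilon,0,n)$ is $(\epsilon,0)$-differentially private for arbitrary data $X\in\mathbb{R}^n$. That is, for every pair of neighboring databases $X,X'\in\mathbb{R}^n$ and every $\mathcal{S}\subseteq\{1,\dots,n\}$, $$\Pr[\mathrm{OfflinePCPD}(X,P_0,P_1,\epsilon,0,n)\in\mathcal{S}]\le e^{\epsilon}\,\Pr[\mathrm{OfflinePCPD}(X',P_0,P_1,\epsilon,0,n)\in\mathcal{S}].$$ No assumption is made on how $X$ is generated.
   Context: $P_0,P_1$ are probability distributions on $\mathbb{R}$, and $P_0(x),P_1(x)$ denote their densities (or mass functions) with respect to a common reference measure. $\log$ is the natural logarithm, with the convention $\log\frac00=0$. For a database $X=\{x_1,\dots,x_n\}$ (an ordered list of $n$ reals) and $k\in\{1,\dots,n\}$, set $$\ell(k)=\ell(k,X)=\sum_{i=k}^n\log\frac{P_1(x_i)}{P_0(x_i)}.$$ The sensitivity of $\ell$ is $$\Delta(\ell)=\max_{x\in\mathbb{R}}\log\frac{P_1(x)}{P_0(x)}-\min_{x'\in\mathbb{R}}\log\frac{P_1(x')}{P_0(x')}$$ (max/min are read as supremum/infimum if not attained). Two databases are neighboring if they differ in at most one entry. $\mathrm{Lap}(b)$ is the Laplace distribution with density $\frac1{2b}e^{-|x|/b}$ (for $b=0$, the point mass at $0$). Algorithm $\mathrm{OfflinePCPD}(X,P_0,P_1,\epsilon,0,n)$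 (the case $\delta=0$): let $A=\Delta(\ell)$; draw $Z_1,\dots,Z_n$ i.i.d. from $\mathrm{Lap}(A/\epsilon)$; output $\tilde k=\mathrm{argmax}_{1\le k\le n}\{\ell(k)+Z_k\}$ (ties, if any, broken by a fixed rule). *)

theory Defs
  imports "HOL-Probability.Probability"
begin

text \<open>
  The log-likelihood ratio takes values in the extended reals, so that a density vanishing at a
  point where the other one is positive is recorded as an infinite value (the real logarithm of the
  library has \<open>ln 0 = 0\<close>, which would hide it). The first case is the convention
  \<open>log (0/0) = 0\<close>.
\<close>

definition log_ratio :: "(real \<Rightarrow> real) \<Rightarrow> (real \<Rightarrow> real) \<Rightarrow> real \<Rightarrow> ereal" where
  "log_ratio p0 p1 x =
     (if p0 x = 0 \<and> p1 x = 0 then 0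
      else if p0 x = 0 then \<infinity>
      else if p1 x = 0 then -\<infinity>
      else ereal (ln (p1 x / p0 x)))"

text \<open>Databases are 0-indexed lists, so the entry \<open>x\<^sub>i\<close> is \<open>X ! (i - 1)\<close>.\<close>

definition ell :: "(real \<Rightarrow> real) \<Rightarrow> (real \<Rightarrow> real) \<Rightarrow> real list \<Rightarrow> nat \<Rightarrow> ereal" where
  "ell p0 p1 X k = (\<Sum>i = k..length X. log_ratio p0 p1 (X ! (i - 1)))"

text \<open>
  In \<^typ>\<open>ereal\<close> we have \<open>\<infinity> - \<infinity> = \<infinity>\<close> and \<open>-\<infinity> - (-\<infinity>) = \<infinity>\<close>, so a finite sensitivity
  forces both extrema to be finite.
\<close>

definition sensitivity :: "(real \<Rightarrow> real) \<Rightarrow> (real \<Rightarrow> real) \<Rightarrow> ereal" where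
  "sensitivity p0 p1 = (SUP x. log_ratio p0 p1 x) - (INF x. log_ratio p0 p1 x)"

definition neighboring :: "'a list \<Rightarrow> 'a list \<Rightarrow> bool" where
  "neighboring X X' \<longleftrightarrow>
     length X = length X' \<and> card {i. i < length X \<and> X ! i \<noteq> X' ! i} \<le> 1"

text \<open>
  A randomized algorithm maps a database to the distribution of its output; \<open>D\<close> is the set of
  admissible databases.
\<close>

definition differentially_private ::
    "real \<Rightarrow> real \<Rightarrow> 'a list set \<Rightarrow> ('a list \<Rightarrow> 'b measure) \<Rightarrow> bool" where
  "differentially_private \<epsilon> \<delta> D M \<longleftrightarrow>
     (\<forall>X\<in>D. \<forall>X'\<in>D. neighboring X X' \<longrightarrow>
        (\<forall>S\<in>sets (M X). measure (M X) S \<le> exp \<epsilon> * measure (M X') S + \<delta>))"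

definition Lap :: "real \<Rightarrow> real measure" where
  "Lap b = (if b = 0 then return borel 0
            else density lborel (\<lambda>x. ennreal (1 / (2 * b) * exp (- \<bar>x\<bar> / b))))"

text \<open>
  A fixed tie-breaking rule selects an index from every nonempty set of tied indices; it depends
  only on that set, not on the database.
\<close>

definition tie_rule :: "nat \<Rightarrow> (nat set \<Rightarrow> nat) \<Rightarrow> bool" where
  "tie_rule n tie \<longleftrightarrow> (\<forall>A. A \<noteq> {} \<and> A \<subseteq> {1..n} \<longrightarrow> tie A \<in> A)"

definition argmax_index :: "(nat set \<Rightarrow> nat) \<Rightarrow> nat \<Rightarrow> (nat \<Rightarrow> ereal) \<Rightarrow> nat" where
  "argmax_index tie n f = tie {k. is_arg_max f (\<lambda>j. j \<in> {1..n}) k}"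

text \<open>
  The output distribution of the algorithm for \<open>\<delta> = 0\<close>, on the discrete space \<open>{1..n}\<close>.
  For finite sensitivity the coercion \<^const>\<open>real_of_ereal\<close> does not change its value.
\<close>

definition OfflinePCPD ::
    "(nat set \<Rightarrow> nat) \<Rightarrow> (real \<Rightarrow> real) \<Rightarrow> (real \<Rightarrow> real) \<Rightarrow> real \<Rightarrow> nat \<Rightarrow> real list \<Rightarrow> nat measure" where
  "OfflinePCPD tie p0 p1 \<epsilon> n X =
     (let A = real_of_ereal (sensitivity p0 p1) in
      distr (\<Pi>\<^sub>M k\<in>{1..n}. Lap (A / \<epsilon>)) (count_space {1..n})
        (\<lambda>Z. argmax_index tie n (\<lambda>k. ell p0 p1 X k + ereal (Z k))))"

text \<open>
  The library's \<^const>\<open>distr\<close> is only meaningful for measurable maps; the following facts show that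
  the algorithm does produce a probability distribution on \<open>{1..n}\<close>.
\<close>

lemma sets_Lap [simp, measurable_cong]: "sets (Lap b) = sets borel"
  by (simp add: Lap_def)

lemma space_Lap [simp]: "space (Lap b) = UNIV"
  by (simp add: Lap_def)

lemma prob_space_Lap:
  assumes "0 \<le> b"
  shows "prob_space (Lap b)"
proof (cases "b = 0")
  case True
  then show ?thesis by (simp add: Lap_def prob_space_return)
next
  case False
  with assms have b: "b > 0" by simp
  let ?e = "\<lambda>x. ennreal (exponential_density (1 / b) x)"
  interpret E: prob_space "density lborel (exponential_density (1 / b))"
    by (rule prob_space_exponential_density) (use b in simp)
  have e1: "(\<integral>\<^sup>+x. ?e x \<partial>lborel) = 1"
    using E.emeasure_space_1 by (simp add: emeasure_density)
  have e2: "(\<integral>\<^sup>+x. ?e (- x) \<partial>lborel) = 1"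
    using nn_integral_real_affine[of ?e "-1" 0] e1 by simp
  define c :: real where "c = 1 / 2"
  have c: "0 \<le> c" "c + c = 1" by (simp_all add: c_def)
  have e: "0 \<le> exponential_density (1 / b) x" for x
    using b by (simp add: exponential_density_nonneg)
  have "(\<integral>\<^sup>+x. ennreal (1 / (2 * b) * exp (- \<bar>x\<bar> / b)) \<partial>lborel) =
        (\<integral>\<^sup>+x. ennreal c * (?e x + ?e (- x)) \<partial>lborel)"
  proof (intro nn_integral_cong_AE AE_mp[OF AE_lborel_singleton[of 0] AE_I2] impI)
    fix x :: real assume "x \<noteq> 0"
    then have "1 / (2 * b) * exp (- \<bar>x\<bar> / b) =
        c * (exponential_density (1 / b) x + exponential_density (1 / b) (- x))"
      using b by (cases "x < 0") (auto simp: exponential_density_def c_def)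
    then show "ennreal (1 / (2 * b) * exp (- \<bar>x\<bar> / b)) = ennreal c * (?e x + ?e (- x))"
      using c(1) e by (simp only: ennreal_mult ennreal_plus add_nonneg_nonneg)
  qed
  also have "\<dots> = ennreal c * (\<integral>\<^sup>+x. ?e x + ?e (- x) \<partial>lborel)"
    by (rule nn_integral_cmult) measurable
  also have "(\<integral>\<^sup>+x. ?e x + ?e (- x) \<partial>lborel) = 1 + 1"
    using e1 e2 by (subst nn_integral_add) auto
  also have "ennreal c * (1 + 1) = ennreal (c + c)"
    using c(1) by (simp only: distrib_left mult_1_right ennreal_plus)
  also have "\<dots> = 1"
    by (simp only: c(2) ennreal_1)
  finally show ?thesis
    using False by (intro prob_spaceI) (simp add: Lap_def emeasure_density)
qed

lemma argmax_set_nonempty: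
  fixes f :: "nat \<Rightarrow> ereal"
  assumes "n \<ge> 1"
  shows "{k. is_arg_max f (\<lambda>j. j \<in> {1..n}) k} \<in> Pow {1..n} - {{}}"
proof -
  have "Max (f ` {1..n}) \<in> f ` {1..n}"
    using assms by (intro Max_in) auto
  then obtain k where "k \<in> {1..n}" "f k = Max (f ` {1..n})" by auto
  then have "is_arg_max f (\<lambda>j. j \<in> {1..n}) k"
    by (auto simp: is_arg_max_linorder)
  moreover have "{k. is_arg_max f (\<lambda>j. j \<in> {1..n}) k} \<subseteq> {1..n}"
    by (auto simp: is_arg_max_def)
  ultimately show ?thesis by blast
qed

lemma measurable_argmax_index:
  assumes "tie_rule n tie" "n \<ge> 1"
  shows "(\<lambda>Z. argmax_index tie n (\<lambda>k. f k + ereal (Z k)))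
           \<in> measurable (\<Pi>\<^sub>M k\<in>{1..n}. Lap b) (count_space {1..n})"
proof -
  let ?M = "\<Pi>\<^sub>M k\<in>{1..n}. Lap b"
  let ?g = "\<lambda>Z k. f k + ereal (Z k)"
  let ?T = "\<lambda>Z. {k. is_arg_max (?g Z) (\<lambda>j. j \<in> {1..n}) k}"
  have T: "?T \<in> measurable ?M (count_space (Pow {1..n} - {{}}))"
  proof (rule measurable_count_space_eq2[THEN iffD2], simp, intro conjI ballI)
    show "?T \<in> space ?M \<rightarrow> Pow {1..n} - {{}}"
      using argmax_set_nonempty[OF assms(2)] by (intro Pi_I)
  next
    fix B assume "B \<in> Pow {1..n} - {{}}"
    then have "?T Z = B \<longleftrightarrow>
        (\<forall>k\<in>{1..n}. k \<in> B \<longleftrightarrow> (\<forall>j\<in>{1..n}. ?g Z j \<le> ?g Z k))" for Z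
      unfolding is_arg_max_linorder set_eq_iff mem_Collect_eq by blast
    then have "?T -` {B} \<inter> space ?M = {Z \<in> space ?M.
        \<forall>k\<in>{1..n}. k \<in> B \<longleftrightarrow> (\<forall>j\<in>{1..n}. ?g Z j \<le> ?g Z k)}"
      by auto
    also have "\<dots> \<in> sets ?M"
    proof (intro sets.sets_Collect_finite_All')
      fix k assume "k \<in> {1..n}"
      have m: "(\<lambda>Z. ?g Z j) \<in> borel_measurable ?M" if "j \<in> {1..n}" for j
      proof -
        have "(\<lambda>Z. Z j) \<in> measurable ?M (Lap b)"
          using that by (rule measurable_component_singleton)
        then have [measurable]: "(\<lambda>Z. Z j) \<in> borel_measurable ?M"
          by (simp add: measurable_def)
        show ?thesis by measurable
      qed
      have le: "{Z \<in> space ?M. \<forall>j\<in>{1..n}. ?g Z j \<le> ?g Z k} \<in> sets ?M"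
        using m \<open>k \<in> {1..n}\<close>
        by (intro sets.sets_Collect_finite_All borel_measurable_le) auto
      show "{Z \<in> space ?M. k \<in> B \<longleftrightarrow> (\<forall>j\<in>{1..n}. ?g Z j \<le> ?g Z k)} \<in> sets ?M"
      proof (cases "k \<in> B")
        case True
        show ?thesis using le by (simp only: True simp_thms)
      next
        case False
        show ?thesis using sets.sets_Collect_neg[OF le] by (simp only: False simp_thms)
      qed
    qed (use assms(2) in simp_all)
    finally show "?T -` {B} \<inter> space ?M \<in> sets ?M" .
  qed
  have "tie \<in> Pow {1..n} - {{}} \<rightarrow> {1..n}"
    using assms(1) unfolding tie_rule_def by blast
  then have "tie \<in> measurable (count_space (Pow {1..n} - {{}})) (count_space {1..n})"
    by (simp only: measurable_count_space_eq1 space_count_space)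
  then show ?thesis
    unfolding argmax_index_def by (rule measurable_compose[OF T])
qed

lemma sensitivity_nonneg: "0 \<le> sensitivity p0 p1"
proof -
  have "(INF x. log_ratio p0 p1 x) \<le> (SUP x. log_ratio p0 p1 x)"
    by (rule INF_le_SUP) simp
  then show ?thesis
    unfolding sensitivity_def
    by (cases "SUP x. log_ratio p0 p1 x"; cases "INF x. log_ratio p0 p1 x") auto
qed

lemma prob_space_OfflinePCPD:
  assumes "tie_rule n tie" "n \<ge> 1" "\<epsilon> > 0"
  shows "prob_space (OfflinePCPD tie p0 p1 \<epsilon> n X)"
proof -
  let ?b = "real_of_ereal (sensitivity p0 p1) / \<epsilon>"
  have "0 \<le> ?b"
    using assms(3) sensitivity_nonneg by (simp add: real_of_ereal_pos)
  then have "prob_space (\<Pi>\<^sub>M k\<in>{1..n}. Lap ?b)"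
    by (intro prob_space_PiM prob_space_Lap)
  then show ?thesis
    unfolding OfflinePCPD_def Let_def
    by (rule prob_space.prob_space_distr) (rule measurable_argmax_index[OF assms(1,2)])
qed

end

theory Submission
  imports Defs
begin

text \<open>
  If \<open>k\<close> is selected under \<open>X\<close>, then after raising the noise \<open>Z\<^sub>k\<close> by any \<open>s > \<Delta>(\<ell>)\<close> it is the
  \<^emph>\<open>unique\<close> maximiser under a neighbouring \<open>X'\<close>, because changing one entry alters the gaps
  \<open>\<ell>(k) - \<ell>(j)\<close> by at most \<open>\<Delta>(\<ell>)\<close>. Shifting a Laplace variable of scale \<open>b\<close> by \<open>s\<close> costs a factor
  \<open>exp (s / b)\<close> in probability, and letting \<open>s\<close> tend to \<open>\<Delta>(\<ell>)\<close> gives the factor \<open>exp \<epsilon>\<close>. The strict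
  inequality makes the tie-breaking rule irrelevant, so that no argument about null sets is needed;
  the degenerate case \<open>\<Delta>(\<ell>) = 0\<close> is trivial since then \<open>\<ell>\<close> does not depend on the database.
\<close>

section \<open>Translating Laplace noise, in one coordinate and inside a product\<close>

lemma nn_integral_Lap:
  assumes "b > 0" "g \<in> borel_measurable borel"
  shows "(\<integral>\<^sup>+y. g y \<partial>Lap b) =
         (\<integral>\<^sup>+y. ennreal (1 / (2 * b) * exp (- \<bar>y\<bar> / b)) * g y \<partial>lborel)"
  using assms by (simp add: Lap_def nn_integral_density)

text \<open>By the triangle inequality
  \<open>\<bar>y + s\<bar> \<le> \<bar>y\<bar> + \<bar>s\<bar>\<close>, the Laplace densities at
  \<open>y\<close> and \<open>y + s\<close> differ by a factor of at most
  \<open>exp (\<bar>s\<bar> / b)\<close>; translation invariance of \<open>lborel\<close> then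
  removes the shift.\<close>

lemma nn_integral_Lap_shift:
  assumes b: "b > 0" and g [measurable]: "g \<in> borel_measurable borel"
  shows "(\<integral>\<^sup>+y. g (y + s) \<partial>Lap b) \<le> ennreal (exp (\<bar>s\<bar> / b)) * (\<integral>\<^sup>+y. g y \<partial>Lap b)"
proof -
  define d where "d y = 1 / (2 * b) * exp (- \<bar>y\<bar> / b)" for y :: real
  have [measurable]: "d \<in> borel_measurable borel"
    unfolding d_def by measurable
  have d: "ennreal (d y) \<le> ennreal (exp (\<bar>s\<bar> / b)) * ennreal (d (y + s))" for y
  proof -
    have "- \<bar>y\<bar> / b \<le> \<bar>s\<bar> / b + - \<bar>y + s\<bar> / b"
      using b by (simp add: field_simps)
    then have "exp (- \<bar>y\<bar> / b) \<le> exp (\<bar>s\<bar> / b) * exp (- \<bar>y + s\<bar> / b)"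
      by (simp only: exp_add[symmetric] exp_le_cancel_iff)
    from mult_left_mono[OF this, of "1 / (2 * b)"] b
    have "d y \<le> exp (\<bar>s\<bar> / b) * d (y + s)"
      by (simp add: d_def mult.left_commute)
    then show ?thesis
      by (simp add: ennreal_mult'[symmetric] ennreal_leI)
  qed
  have "(\<integral>\<^sup>+y. g (y + s) \<partial>Lap b) = (\<integral>\<^sup>+y. ennreal (d y) * g (y + s) \<partial>lborel)"
    unfolding d_def using b by (rule nn_integral_Lap) measurable
  also have "\<dots> \<le> (\<integral>\<^sup>+y. ennreal (exp (\<bar>s\<bar> / b)) * (ennreal (d (y + s)) * g (y + s)) \<partial>lborel)"
    using d by (intro nn_integral_mono) (simp add: mult.assoc[symmetric] mult_right_mono)
  also have "\<dots> = ennreal (exp (\<bar>s\<bar> / b)) * (\<integral>\<^sup>+y. ennreal (d (y + s)) * g (y + s) \<partial>lborel)"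
    by (rule nn_integral_cmult) measurable
  also have "(\<integral>\<^sup>+y. ennreal (d (y + s)) * g (y + s) \<partial>lborel) = (\<integral>\<^sup>+y. ennreal (d y) * g y \<partial>lborel)"
    using nn_integral_real_affine[of "\<lambda>y. ennreal (d y) * g y" 1 s] by (simp add: add.commute)
  also have "\<dots> = (\<integral>\<^sup>+y. g y \<partial>Lap b)"
    unfolding d_def using b by (rule nn_integral_Lap[symmetric]) measurable
  finally show ?thesis .
qed

text \<open>Fubini isolates coordinate \<open>k\<close>. With the other coordinates frozen, the
  section of \<open>E\<close> moved by \<open>s\<close> lies inside the section of
  \<open>E'\<close>, so the one-dimensional bound applies and can be integrated.\<close>

lemma emeasure_PiM_Lap_shift:
  assumes I: "finite I" "k \<in> I" and b: "b > 0"
    and E: "E \<in> sets (\<Pi>\<^sub>M i\<in>I. Lap b)" and E': "E' \<in> sets (\<Pi>\<^sub>M i\<in>I. Lap b)"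
    and sub: "\<And>Z. Z \<in> E \<Longrightarrow> Z(k := Z k + s) \<in> E'"
  shows "emeasure (\<Pi>\<^sub>M i\<in>I. Lap b) E
           \<le> ennreal (exp (\<bar>s\<bar> / b)) * emeasure (\<Pi>\<^sub>M i\<in>I. Lap b) E'"
proof -
  interpret L: prob_space "Lap b"
    using b by (intro prob_space_Lap) simp
  interpret P: product_sigma_finite "\<lambda>_. Lap b"
    by (simp add: product_sigma_finite_def L.sigma_finite_measure_axioms)
  define J where "J = I - {k}"
  have J: "finite J" "k \<notin> J" "I = insert k J"
    using I by (auto simp: J_def)
  have fub: "emeasure (\<Pi>\<^sub>M i\<in>I. Lap b) F =
      (\<integral>\<^sup>+x. (\<integral>\<^sup>+y. indicator F (x(k := y)) \<partial>Lap b) \<partial>(\<Pi>\<^sub>M i\<in>J. Lap b))"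
    if "F \<in> sets (\<Pi>\<^sub>M i\<in>I. Lap b)" for F
    using P.product_nn_integral_insert[OF J(1,2), of "indicator F"] that
    by (simp add: J(3))
  have "(\<integral>\<^sup>+y. indicator E (x(k := y)) \<partial>Lap b)
      \<le> ennreal (exp (\<bar>s\<bar> / b)) * (\<integral>\<^sup>+y. indicator E' (x(k := y)) \<partial>Lap b)"
    if x: "x \<in> space (\<Pi>\<^sub>M i\<in>J. Lap b)" for x
  proof -
    have upd: "(\<lambda>y. x(k := y)) \<in> measurable (Lap b) (\<Pi>\<^sub>M i\<in>I. Lap b)"
      unfolding J(3) by (rule measurable_fun_upd[where J=J]) (use x in auto)
    have m: "(\<lambda>y. indicator E' (x(k := y)) :: ennreal) \<in> borel_measurable borel"
      using measurable_compose[OF upd borel_measurable_indicator[OF E']]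
      by (simp add: measurable_cong_sets[OF sets_Lap refl])
    \<comment> \<open>Two successive updates at \<open>k\<close> collapse, so \<open>sub\<close> at
      \<open>x(k := y)\<close> yields the point \<open>x(k := y + s)\<close>.\<close>
    have "(\<integral>\<^sup>+y. indicator E (x(k := y)) \<partial>Lap b) \<le> (\<integral>\<^sup>+y. indicator E' (x(k := y + s)) \<partial>Lap b)"
      using sub[of "x(k := y)" for y] by (intro nn_integral_mono) (auto simp: indicator_def)
    also have "\<dots> \<le> ennreal (exp (\<bar>s\<bar> / b)) * (\<integral>\<^sup>+y. indicator E' (x(k := y)) \<partial>Lap b)"
      using nn_integral_Lap_shift[OF b m] .
    finally show ?thesis .
  qed
  then have "emeasure (\<Pi>\<^sub>M i\<in>I. Lap b) E \<le> (\<integral>\<^sup>+x. ennreal (exp (\<bar>s\<bar> / b)) *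
      (\<integral>\<^sup>+y. indicator E' (x(k := y)) \<partial>Lap b) \<partial>(\<Pi>\<^sub>M i\<in>J. Lap b))"
    unfolding fub[OF E] by (rule nn_integral_mono)
  also have "\<dots> = ennreal (exp (\<bar>s\<bar> / b)) * emeasure (\<Pi>\<^sub>M i\<in>I. Lap b) E'"
    unfolding fub[OF E']
  proof (rule nn_integral_cmult)
    have "(\<lambda>(x, y). x(k := y)) \<in> measurable ((\<Pi>\<^sub>M i\<in>J. Lap b) \<Otimes>\<^sub>M Lap b) (\<Pi>\<^sub>M i\<in>I. Lap b)"
      unfolding J(3) by (rule measurable_add_dim)
    from measurable_compose[OF this borel_measurable_indicator[OF E']]
    show "(\<lambda>x. \<integral>\<^sup>+y. indicator E' (x(k := y)) \<partial>Lap b) \<in> borel_measurable (\<Pi>\<^sub>M i\<in>J. Lap b)"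
      by (intro L.borel_measurable_nn_integral) (simp add: case_prod_unfold)
  qed
  finally show ?thesis .
qed

section \<open>Selection of a noisy maximiser\<close>

lemma is_arg_max_argmax_index:
  assumes "tie_rule n tie" "n \<ge> 1"
  shows "is_arg_max f (\<lambda>j. j \<in> {1..n}) (argmax_index tie n f)"
proof -
  define T where "T = {k. is_arg_max f (\<lambda>j. j \<in> {1..n}) k}"
  have "T \<noteq> {} \<and> T \<subseteq> {1..n}"
    using argmax_set_nonempty[OF assms(2), of f, folded T_def] by simp
  then have "tie T \<in> T"
    using assms(1) unfolding tie_rule_def by blast
  then have "is_arg_max f (\<lambda>j. j \<in> {1..n}) (tie T)"
    by (simp only: T_def mem_Collect_eq)
  then show ?thesis
    by (simp only: argmax_index_def T_def)
qed

lemma argmax_index_eqI: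
  assumes "tie_rule n tie" "k \<in> {1..n}" "\<And>j. j \<in> {1..n} \<Longrightarrow> j \<noteq> k \<Longrightarrow> f j < f k"
  shows "argmax_index tie n f = k"
proof -
  have "is_arg_max f (\<lambda>j. j \<in> {1..n}) (argmax_index tie n f)"
    using assms(1,2) by (intro is_arg_max_argmax_index) auto
  with assms(2,3) show ?thesis
    by (auto simp: is_arg_max_def)
qed

text \<open>Only the loss in the lead of \<open>k\<close> over each competitor matters. Bounding
  this loss, not the change of each single score, avoids a factor
  \<open>exp (2 * A / b)\<close>.\<close>

lemma noisy_argmax_singleton_le:
  fixes f f' :: "nat \<Rightarrow> real" and n :: nat and b :: real and tie :: "nat set \<Rightarrow> nat"
  defines "N \<equiv> \<lambda>f. distr (\<Pi>\<^sub>M k\<in>{1..n}. Lap b) (count_space {1..n})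
                    (\<lambda>Z. argmax_index tie n (\<lambda>k. ereal (f k) + ereal (Z k)))"
  assumes tie: "tie_rule n tie" and k: "k \<in> {1..n}" and b: "b > 0" and A: "A \<ge> 0"
    and gap: "\<And>j. j \<in> {1..n} \<Longrightarrow> (f k - f j) - (f' k - f' j) \<le> A"
  shows "measure (N f) {k} \<le> exp (A / b) * measure (N f') {k}"
proof -
  let ?M = "\<Pi>\<^sub>M k\<in>{1..n}. Lap b"
  let ?h = "\<lambda>f Z. argmax_index tie n (\<lambda>k. ereal (f k) + ereal (Z k))"
  have n: "n \<ge> 1"
    using k by simp
  have h: "?h f \<in> measurable ?M (count_space {1..n})" for f :: "nat \<Rightarrow> real"
    using tie n by (rule measurable_argmax_index)
  interpret M: prob_space ?M
    using b by (intro prob_space_PiM prob_space_Lap) simp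
  define E where "E f = ?h f -` {k} \<inter> space ?M" for f
  have E: "E f \<in> sets ?M" for f
    unfolding E_def using h by (rule measurable_sets) (use k in simp)
  have N: "measure (N f) {k} = measure ?M (E f)" for f
    unfolding N_def E_def using h k by (subst measure_distr) auto
  have le: "measure ?M (E f) \<le> exp (s / b) * measure ?M (E f')" if s: "A < s" for s
  proof -
    have "emeasure ?M (E f) \<le> ennreal (exp (\<bar>s\<bar> / b)) * emeasure ?M (E f')"
    proof (rule emeasure_PiM_Lap_shift[OF _ k b E E])
      fix Z assume Z: "Z \<in> E f"
      then have "is_arg_max (\<lambda>k. ereal (f k) + ereal (Z k)) (\<lambda>j. j \<in> {1..n}) k"
        using is_arg_max_argmax_index[OF tie n] by (auto simp: E_def)
      then have max: "f j + Z j \<le> f k + Z k" if "j \<in> {1..n}" for j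
        using that by (auto simp: is_arg_max_linorder)
      have "?h f' (Z(k := Z k + s)) = k"
      proof (rule argmax_index_eqI[OF tie k])
        fix j assume "j \<in> {1..n}" "j \<noteq> k"
        \<comment> \<open>The chain is \<open>f' j - f' k \<le> A - (f k - f j) \<le> A + Z k - Z j
          < s + Z k - Z j\<close>.\<close>
        then show "ereal (f' j) + ereal ((Z(k := Z k + s)) j)
            < ereal (f' k) + ereal ((Z(k := Z k + s)) k)"
          using max[of j] gap[of j] s by simp
      qed
      moreover have "Z(k := Z k + s) \<in> space ?M"
        using Z k by (auto simp: E_def space_PiM PiE_def extensional_def)
      ultimately show "Z(k := Z k + s) \<in> E f'"
        by (simp add: E_def)
    qed simp
    then show ?thesis
      using A s by (simp add: M.emeasure_eq_measure ennreal_mult'[symmetric] del: One_nat_def)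
  qed
  \<comment> \<open>The bound holds for every \<open>s > A\<close>, so it survives the limit from
    the right; \<open>A + 1\<close> below merely fixes a right neighbourhood of
    \<open>A\<close>.\<close>
  have "((\<lambda>s. exp (s / b) * measure ?M (E f')) \<longlongrightarrow> exp (A / b) * measure ?M (E f')) (at_right A)"
    using b by (intro tendsto_intros) auto
  then have "measure ?M (E f) \<le> exp (A / b) * measure ?M (E f')"
    by (rule tendsto_lowerbound)
      (use le in \<open>auto simp: eventually_at_right_field intro: exI[of _ "A + 1"]\<close>)
  then show ?thesis
    by (simp add: N)
qed

section \<open>Sensitivity and the effect of changing one entry\<close>

text \<open>Every log-ratio is trapped between two finite extrema, which permits passing from
  \<open>ereal\<close> to real arithmetic.\<close>

lemma finite_sensitivity:
  assumes "sensitivity p0 p1 < \<infinity>"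
  shows "log_ratio p0 p1 x = ereal (real_of_ereal (log_ratio p0 p1 x))"
    and "real_of_ereal (log_ratio p0 p1 x) - real_of_ereal (log_ratio p0 p1 y)
           \<le> real_of_ereal (sensitivity p0 p1)"
proof -
  let ?S = "SUP x. log_ratio p0 p1 x" and ?I = "INF x. log_ratio p0 p1 x"
  have fin: "?S < \<infinity>" "-\<infinity> < ?I"
    using assms unfolding sensitivity_def by (cases ?S; cases ?I; simp)+
  have bd: "?I \<le> log_ratio p0 p1 z" "log_ratio p0 p1 z \<le> ?S" for z
    by (auto intro: INF_lower SUP_upper)
  have real: "log_ratio p0 p1 z = ereal (real_of_ereal (log_ratio p0 p1 z))" for z
    using fin bd[of z] by (cases "log_ratio p0 p1 z") auto
  then show "log_ratio p0 p1 x = ereal (real_of_ereal (log_ratio p0 p1 x))" .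
  have "log_ratio p0 p1 x - log_ratio p0 p1 y \<le> sensitivity p0 p1"
    unfolding sensitivity_def by (intro ereal_minus_mono bd)
  then have "ereal (real_of_ereal (log_ratio p0 p1 x) - real_of_ereal (log_ratio p0 p1 y))
      \<le> sensitivity p0 p1"
    using real[of x] real[of y] by (metis ereal_minus(1))
  then show "real_of_ereal (log_ratio p0 p1 x) - real_of_ereal (log_ratio p0 p1 y)
      \<le> real_of_ereal (sensitivity p0 p1)"
    using assms by (cases "sensitivity p0 p1") auto
qed

lemma neighboringD:
  assumes "neighboring X X'" "X \<noteq> []"
  obtains t where "t < length X" "\<And>i. i < length X \<Longrightarrow> i \<noteq> t \<Longrightarrow> X ! i = X' ! i"
proof -
  let ?D = "{i. i < length X \<and> X ! i \<noteq> X' ! i}"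
  have D: "card ?D \<le> 1" "finite ?D"
    using assms(1) by (auto simp: neighboring_def)
  show thesis
  proof (cases "?D = {}")
    case True
    \<comment> \<open>The databases agree everywhere, so any valid position serves as
      \<open>t\<close>.\<close>
    then show thesis using that[of 0] assms(2) by auto
  next
    case False
    with D have "card ?D = 1"
      by (metis card_0_eq le_antisym less_one linorder_not_less)
    then obtain t where "?D = {t}"
      by (rule card_1_singletonE)
    then show thesis using that[of t] by blast
  qed
qed

text \<open>Only the summand \<open>i = Suc t\<close> reads the changed entry, so every suffix sum
  moves by the same amount or not at all.\<close>

lemma sum_suffix_neighboring_diff:
  fixes r :: "'a \<Rightarrow> real"
  assumes X: "length X = n" "length X' = n"
    and t: "t < n" "\<And>i. i < n \<Longrightarrow> i \<noteq> t \<Longrightarrow> X ! i = X' ! i" and k: "k \<ge> 1"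
  shows "(\<Sum>i = k..n. r (X ! (i - 1))) - (\<Sum>i = k..n. r (X' ! (i - 1)))
           = (if k \<le> Suc t then r (X ! t) - r (X' ! t) else 0)"
proof -
  have "(\<Sum>i = k..n. r (X ! (i - 1))) - (\<Sum>i = k..n. r (X' ! (i - 1)))
      = (\<Sum>i = k..n. if i = Suc t then r (X ! t) - r (X' ! t) else 0)"
    unfolding sum_subtractf[symmetric]
  proof (rule sum.cong[OF refl])
    fix i assume "i \<in> {k..n}"
    then show "r (X ! (i - 1)) - r (X' ! (i - 1)) = (if i = Suc t then r (X ! t) - r (X' ! t) else 0)"
      \<comment> \<open>\<open>k \<ge> 1\<close> excludes \<open>i = 0\<close>, where truncated
        subtraction would read entry 0 a second time.\<close>
      using t(2)[of "i - 1"] k by (cases i) auto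
  qed
  also have "\<dots> = (if k \<le> Suc t then r (X ! t) - r (X' ! t) else 0)"
    using t(1) by simp
  finally show ?thesis .
qed

theorem theorem4:
  fixes \<mu> P0 P1 :: "real measure" and p0 p1 :: "real \<Rightarrow> real"
    and \<epsilon> :: real and n :: nat and tie :: "nat set \<Rightarrow> nat"
  assumes "real_distribution P0" and "real_distribution P1"
    and "sets \<mu> = sets borel"
    and "p0 \<in> borel_measurable borel" and "\<And>x. 0 \<le> p0 x"
    and "P0 = density \<mu> (\<lambda>x. ennreal (p0 x))"
    and "p1 \<in> borel_measurable borel" and "\<And>x. 0 \<le> p1 x"
    and "P1 = density \<mu> (\<lambda>x. ennreal (p1 x))"
    and "sensitivity p0 p1 < \<infinity>"
    and "\<epsilon> > 0" and "n \<ge> 1"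
    and "tie_rule n tie"
  shows "differentially_private \<epsilon> 0 {X. length X = n} (OfflinePCPD tie p0 p1 \<epsilon> n)"
  unfolding differentially_private_def
proof (intro ballI impI)
  fix X X' :: "real list" and S
  assume X: "X \<in> {X. length X = n}" and X': "X' \<in> {X. length X = n}"
    and nb: "neighboring X X'" and S: "S \<in> sets (OfflinePCPD tie p0 p1 \<epsilon> n X)"
  define A where "A = real_of_ereal (sensitivity p0 p1)"
  define r where "r x = real_of_ereal (log_ratio p0 p1 x)" for x
  define f where "f X k = (\<Sum>i = k..n. r (X ! (i - 1)))" for X :: "real list" and k
  let ?P = "OfflinePCPD tie p0 p1 \<epsilon> n"
  have r: "log_ratio p0 p1 x = ereal (r x)" "r x - r y \<le> A" for x y
    using finite_sensitivity[OF assms(10)] by (simp_all add: r_def A_def)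
  have A: "A \<ge> 0"
    using r(2)[of 0 0] by simp
  have P: "?P Y = distr (\<Pi>\<^sub>M k\<in>{1..n}. Lap (A / \<epsilon>)) (count_space {1..n})
      (\<lambda>Z. argmax_index tie n (\<lambda>k. ereal (f Y k) + ereal (Z k)))" if "length Y = n" for Y
    by (simp only: OfflinePCPD_def Let_def A_def ell_def that f_def r(1) sum_ereal)
  have len: "length X = n" "length X' = n"
    using X X' by auto
  then have "X \<noteq> []"
    using assms(12) by auto
  with nb obtain t where t: "t < n" "\<And>i. i < n \<Longrightarrow> i \<noteq> t \<Longrightarrow> X ! i = X' ! i"
    by (rule neighboringD) (use len in auto)
  have diff: "f X k - f X' k = (if k \<le> Suc t then r (X ! t) - r (X' ! t) else 0)" if "k \<ge> 1" for k
    unfolding f_def using len t that by (rule sum_suffix_neighboring_diff)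
  \<comment> \<open>Both differences lie in \<open>{0, c}\<close> for the common
    \<open>c = r (X ! t) - r (X' ! t)\<close>, so they can differ by at most
    \<open>\<bar>c\<bar> \<le> A\<close>.\<close>
  have gap: "(f X k - f X j) - (f X' k - f X' j) \<le> A" if "k \<in> {1..n}" "j \<in> {1..n}" for j k
    using that diff[of k] diff[of j] A r(2)[of "X ! t" "X' ! t"] r(2)[of "X' ! t" "X ! t"]
    by (auto split: if_splits)
  have S: "S \<subseteq> {1..n}"
    using S by (simp add: P len)
  \<comment> \<open>As the output space is finite and the additive term is 0, the bound for
    singletons can be summed over \<open>S\<close>.\<close>
  have single: "measure (?P X) {k} \<le> exp \<epsilon> * measure (?P X') {k}" if k: "k \<in> {1..n}" for k
  proof (cases "A = 0")
    case True
    then have "r (X ! t) = r (X' ! t)"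
      using r(2)[of "X ! t" "X' ! t"] r(2)[of "X' ! t" "X ! t"] by simp
    then have "f X j = f X' j" if "j \<in> {1..n}" for j
      using diff[of j] that by (auto split: if_splits)
    \<comment> \<open>Equal scores on \<open>{1..n}\<close> give equal sets of maximisers, and
      \<open>tie\<close> sees nothing but this set.\<close>
    then have "is_arg_max (\<lambda>k. ereal (f X k) + ereal (Z k)) (\<lambda>j. j \<in> {1..n})
        = is_arg_max (\<lambda>k. ereal (f X' k) + ereal (Z k)) (\<lambda>j. j \<in> {1..n})" for Z
      by (auto simp: is_arg_max_linorder fun_eq_iff)
    then have "?P X = ?P X'"
      by (simp only: P len argmax_index_def)
    moreover have "1 * measure (?P X') {k} \<le> exp \<epsilon> * measure (?P X') {k}"
      using assms(11) by (intro mult_right_mono) auto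
    ultimately show ?thesis by simp
  next
    case False
    \<comment> \<open>The noise scale \<open>A / \<epsilon>\<close> is chosen so that the factor
      \<open>exp (A / b)\<close> becomes \<open>exp \<epsilon>\<close>.\<close>
    with A assms(11) have b: "A / \<epsilon> > 0" "A / (A / \<epsilon>) = \<epsilon>"
      by auto
    show ?thesis
      using noisy_argmax_singleton_le[where f = "f X" and f' = "f X'", OF assms(13) k b(1) A gap[OF k]]
      unfolding b(2) by (simp only: P len)
  qed
  have sum: "measure (?P Y) S = (\<Sum>k\<in>S. measure (?P Y) {k})" if "length Y = n" for Y
  proof -
    interpret prob_space "?P Y"
      using assms(13,12,11) by (rule prob_space_OfflinePCPD)
    show ?thesis
      using S by (intro finite_measure_eq_sum_singleton) (auto simp: P that intro: finite_subset)
  qed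
  have "measure (?P X) S \<le> (\<Sum>k\<in>S. exp \<epsilon> * measure (?P X') {k})"
    unfolding sum[OF len(1)] using single S by (intro sum_mono) auto
  then show "measure (?P X) S \<le> exp \<epsilon> * measure (?P X') S + 0"
    by (simp add: sum[OF len(2)] sum_distrib_left)
qed

end
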